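(* Let $d\ge2$, let $r\in\,]0,1[$, and consider a system of three inelastic particles $0,1,2$ in $\mathbb{R}^d$ evolving according to the $r$-inelastic hard sphere flow on a time interval $[0,\tau^*[$ and undergoing a triangular inelastic collapse at time $\tau^*>0$. Then the three particles $0,1,2$ are in contact at the collapsing time $\tau^*$, that is, $$|\overline\omega_1|=1,\qquad|\overline\omega_2|=1\qquad\text{and}\qquad|\overline\omega_2-\overline\omega_1|=1,$$ where $\overline\omega_i=\lim_{n\to+\infty}\big(x_i(t_n)-x_0(t_n)\big)$ for $i\in\{1,2\}$, $(t_n)_n$ being the sequence of collision times.
   Context: Model. Three identical spherical particles $0,1,2$ of diameter $1$ in $\mathbb{R}^d$ ($d\ge2$), with positions $x_i$ and velocities $v_i$, and $|x_i-x_j|\ge1$ for $i\ne j$. The $r$-inelastic hard sphere flow, $r\in\,]0,1[$: between collisions each particle moves in a straight line with constant velocity; when $|x_i-x_j|=1$ for a pair $i\neq j$ (a collision of type $i$-$j$), the velocities of these two particles are immediately changed into $v_i'=v_i-\frac{1+r}{2}\big((v_i-v_j)\cdot\omega\big)\omega$ and $v_j'=v_j+\frac{1+r}{2}\big((v_i-v_j)\cdot\omega\big)\omega$, with $\omega=(x_i-x_j)/|x_i-x_j|$, the velocity of the third particle being unchanged. Inelastic collapse at time $\tau^*>0$: the system evolves according to this flow on $[0,\tau^*[$ and there is an increasing sequence $(t_n)_{n\in\mathbb{N}}$ with $t_0=0$, $t_n\to\tau^*$, such that the $t_n$ are exactly the times of collisions (no accumulation point other than $\tau^*$, free motion on each $]t_n,t_{n+1}[$).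 Only well-defined trajectories are considered: no triple collision and no grazing collision takes place on $[0,\tau^*[$. Triangular collapse: an inelastic collapse whose sequence of collisions contains infinitely many collisions of each of the three types $0$-$1$, $0$-$2$, $1$-$2$. In an inelastic collapse the limits $\overline\omega_i$ exist. *)

theory Defs
  imports "HOL-Analysis.Analysis"
begin

type_synonym 'a trajectory = "nat \<Rightarrow> real \<Rightarrow> 'a"

abbreviation particles :: "nat set" where
  "particles \<equiv> {0, 1, 2}"

definition contact :: "('a::euclidean_space) trajectory \<Rightarrow> real \<Rightarrow> nat \<Rightarrow> nat \<Rightarrow> bool" where
  "contact x t i j \<longleftrightarrow>
     i \<in> particles \<and> j \<in> particles \<and> i \<noteq> j \<and> norm (x i t - x j t) = 1"

definition collision_times :: "real \<Rightarrow> ('a::euclidean_space) trajectory \<Rightarrow> real set" where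
  "collision_times \<tau> x = {t \<in> {0..<\<tau>}. \<exists>i j. contact x t i j}"

definition collision_rule ::
  "real \<Rightarrow> nat \<Rightarrow> nat \<Rightarrow> 'a::euclidean_space \<Rightarrow> (nat \<Rightarrow> 'a) \<Rightarrow> (nat \<Rightarrow> 'a) \<Rightarrow> bool" where
  "collision_rule r i j \<omega> u u' \<longleftrightarrow>
     u' i = u i - ((1 + r) / 2 * ((u i - u j) \<bullet> \<omega>)) *\<^sub>R \<omega> \<and>
     u' j = u j + ((1 + r) / 2 * ((u i - u j) \<bullet> \<omega>)) *\<^sub>R \<omega> \<and>
     (\<forall>k \<in> particles - {i, j}. u' k = u k)"

text \<open>Velocities are taken left-continuous: at a collision time \<open>t\<close>, the value \<open>v i t\<close> is the
  velocity immediately before the collision (at \<open>t = 0\<close> it is the initial velocity), and the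
  velocities immediately after time \<open>t\<close> are the \<open>u'\<close> below.\<close>

definition velocities_after ::
  "real \<Rightarrow> ('a::euclidean_space) trajectory \<Rightarrow> 'a trajectory \<Rightarrow> real \<Rightarrow> (nat \<Rightarrow> 'a) \<Rightarrow> bool" where
  "velocities_after r x v t u' \<longleftrightarrow>
     (\<forall>i j. contact x t i j \<longrightarrow>
        collision_rule r i j (sgn (x i t - x j t)) (\<lambda>k. v k t) u') \<and>
     ((\<nexists>i j. contact x t i j) \<longrightarrow> (\<forall>k \<in> particles. u' k = v k t))"

text \<open>The last conjunct expresses both the free motion between collisions and the velocity jumps:
  on every interval whose interior contains no collision time, the particles leave the left
  endpoint with the velocities prescribed there and keep them up to the right endpoint, included
  because of left-continuity.\<close>

definition inelastic_flow ::
  "real \<Rightarrow> real \<Rightarrow> ('a::euclidean_space) trajectory \<Rightarrow> 'a trajectory \<Rightarrow> bool" where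
  "inelastic_flow r \<tau> x v \<longleftrightarrow>
     (\<forall>t \<in> {0..<\<tau>}. \<forall>i \<in> particles. \<forall>j \<in> particles. i \<noteq> j \<longrightarrow> norm (x i t - x j t) \<ge> 1) \<and>
     (\<forall>a b. 0 \<le> a \<and> a < b \<and> b < \<tau> \<and> {a<..<b} \<inter> collision_times \<tau> x = {} \<longrightarrow>
        (\<exists>u'. velocities_after r x v a u' \<and>
           (\<forall>k \<in> particles. \<forall>s \<in> {a<..b}. v k s = u' k \<and> x k s = x k a + (s - a) *\<^sub>R u' k)))"

text \<open>With three particles, two distinct colliding pairs always share a particle.\<close>

definition no_triple_collision :: "real \<Rightarrow> ('a::euclidean_space) trajectory \<Rightarrow> bool" where
  "no_triple_collision \<tau> x \<longleftrightarrow>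
     (\<forall>t \<in> {0..<\<tau>}. \<not> (\<exists>i j k. j \<noteq> k \<and> contact x t i j \<and> contact x t i k))"

definition no_grazing_collision ::
  "real \<Rightarrow> ('a::euclidean_space) trajectory \<Rightarrow> 'a trajectory \<Rightarrow> bool" where
  "no_grazing_collision \<tau> x v \<longleftrightarrow>
     (\<forall>t \<in> {0..<\<tau>}. \<forall>i j. contact x t i j \<longrightarrow> (v i t - v j t) \<bullet> sgn (x i t - x j t) \<noteq> 0)"

definition inelastic_collapse ::
  "real \<Rightarrow> real \<Rightarrow> ('a::euclidean_space) trajectory \<Rightarrow> 'a trajectory \<Rightarrow> (nat \<Rightarrow> real) \<Rightarrow> bool" where
  "inelastic_collapse r \<tau> x v t \<longleftrightarrow>
     0 < \<tau> \<and> inelastic_flow r \<tau> x v \<and>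
     no_triple_collision \<tau> x \<and> no_grazing_collision \<tau> x v \<and>
     strict_mono t \<and> t 0 = 0 \<and> t \<longlonglongrightarrow> \<tau> \<and> range t = collision_times \<tau> x"

definition triangular_collapse ::
  "real \<Rightarrow> real \<Rightarrow> ('a::euclidean_space) trajectory \<Rightarrow> 'a trajectory \<Rightarrow> (nat \<Rightarrow> real) \<Rightarrow> bool" where
  "triangular_collapse r \<tau> x v t \<longleftrightarrow>
     inelastic_collapse r \<tau> x v t \<and>
     infinite {n. contact x (t n) 0 1} \<and>
     infinite {n. contact x (t n) 0 2} \<and>
     infinite {n. contact x (t n) 1 2}"

definition limit_position ::
  "('a::euclidean_space) trajectory \<Rightarrow> (nat \<Rightarrow> real) \<Rightarrow> nat \<Rightarrow> 'a" where
  "limit_position x t i = lim (\<lambda>n. x i (t n) - x 0 (t n))"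

end

theory Submission
  imports Defs
begin

text \<open>Collisions do not increase the kinetic energy, so the velocities are bounded and the positions
  at collision times move by at most a constant times the elapsed time; as \<open>\<tau>\<close> is finite they
  converge. Each pair of particles is at distance 1 along a subsequence of the collision
  times, hence also in the limit.\<close>

text \<open>The bounds on the increments telescope to a convergent series because \<open>t\<close>
  converges. By comparison the increments of \<open>f\<close> are summable in a Banach space, and
  their partial sums are \<open>f n - f 0\<close>.\<close>

lemma convergent_if_norm_diff_le_mult_diff:
  fixes f :: "nat \<Rightarrow> 'a::banach" and t :: "nat \<Rightarrow> real"
  assumes "convergent t" and "\<And>n. norm (f (Suc n) - f n) \<le> M * (t (Suc n) - t n)"
  shows "convergent f"
proof -
  have "summable (\<lambda>n. M * (t (Suc n) - t n))"
    using assms(1) by (auto simp: convergent_def intro!: summable_mult telescope_summable)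
  then have "summable (\<lambda>n. f (Suc n) - f n)"
    by (rule summable_comparison_test') (use assms(2) in auto)
  then have "convergent (\<lambda>n. \<Sum>k<n. f (Suc k) - f k)"
    by (simp add: summable_iff_convergent)
  then have "convergent (\<lambda>n. (f n - f 0) + f 0)"
    by (intro convergent_add) (auto simp: sum_lessThan_telescope convergent_const)
  then show ?thesis by simp
qed

lemma norm_lim_eq_if_infinite:
  fixes f :: "nat \<Rightarrow> 'a::real_normed_vector"
  assumes "convergent f" and "infinite {n. norm (f n) = c}"
  shows "norm (lim f) = c"
proof -
  obtain s :: "nat \<Rightarrow> nat" where s: "strict_mono s" "\<And>n. norm (f (s n)) = c"
    using infinite_enumerate[OF assms(2)] by auto
  have "(f \<circ> s) \<longlonglongrightarrow> lim f"
    using assms(1) s(1) by (intro LIMSEQ_subseq_LIMSEQ) (simp_all add: convergent_LIMSEQ_iff)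
  then have "(\<lambda>n. norm (f (s n))) \<longlonglongrightarrow> norm (lim f)"
    unfolding comp_def by (rule tendsto_norm)
  then show ?thesis
    by (simp add: s(2) LIMSEQ_const_iff)
qed

text \<open>Only the normal component \<open>s\<close> of the relative velocity is damped: the sum
  of squared norms changes by -(1 - r^2)/2 * s^2, which is nonpositive for |r| \<le> 1.\<close>

lemma collision_energy_le:
  assumes "collision_rule r i j \<omega> u u'" and "i \<in> particles" "j \<in> particles" "i \<noteq> j"
    and "norm \<omega> = 1" and "\<bar>r\<bar> \<le> 1"
  shows "(\<Sum>k\<in>particles. (norm (u' k))\<^sup>2) \<le> (\<Sum>k\<in>particles. (norm (u k))\<^sup>2)"
proof -
  define s where "s = (u i - u j) \<bullet> \<omega>"
  define c where "c = (1 + r) / 2 * s"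
  have u': "u' i = u i - c *\<^sub>R \<omega>" "u' j = u j + c *\<^sub>R \<omega>" "\<And>k. k \<in> particles - {i, j} \<Longrightarrow> u' k = u k"
    using assms(1) by (auto simp: collision_rule_def c_def s_def)
  \<comment> \<open>Since \<open>\<omega>\<close> is a unit vector, the two squares contribute
    \<open>2 * c\<^sup>2\<close>, and the cross terms combine to \<open>- 2 * c * s\<close>.\<close>
  have "(norm (u' i))\<^sup>2 + (norm (u' j))\<^sup>2 = (norm (u i))\<^sup>2 + (norm (u j))\<^sup>2 + 2 * c * (c - s)"
    using \<open>norm \<omega> = 1\<close> unfolding u' power2_norm_eq_inner s_def norm_eq_1
    by (simp add: algebra_simps inner_commute)
  moreover have "2 * c * (c - s) = - (1 - r\<^sup>2) / 2 * s\<^sup>2"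
    by (simp add: c_def field_simps power2_eq_square)
  moreover have "r\<^sup>2 \<le> 1"
    using \<open>\<bar>r\<bar> \<le> 1\<close> by (simp add: abs_square_le_1)
  ultimately have "(norm (u' i))\<^sup>2 + (norm (u' j))\<^sup>2 \<le> (norm (u i))\<^sup>2 + (norm (u j))\<^sup>2"
    by (simp add: mult_nonpos_nonneg)
  moreover have split: "sum f particles = f i + f j + sum f (particles - {i, j})" for f :: "nat \<Rightarrow> real"
    using assms(2-4) sum.subset_diff[of "{i, j}" particles f] by simp
  moreover have "(\<Sum>k\<in>particles - {i, j}. (norm (u' k))\<^sup>2) = (\<Sum>k\<in>particles - {i, j}. (norm (u k))\<^sup>2)"
    by (rule sum.cong) (simp_all only: u'(3))
  ultimately show ?thesis
    unfolding split[of "\<lambda>k. (norm (_ k))\<^sup>2"] by linarith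
qed

text \<open>The flow condition applies to the interval from \<open>t n\<close> to
  \<open>t (Suc n)\<close>. By left-continuity, \<open>v k (t (Suc n))\<close> is the velocity just
  after the collision at \<open>t n\<close>; hence the index \<open>Suc n\<close> in the
  displacement formula.\<close>

lemma collapse_step:
  assumes "inelastic_collapse r \<tau> x v t" and "\<bar>r\<bar> \<le> 1"
  shows "(\<Sum>k\<in>particles. (norm (v k (t (Suc n))))\<^sup>2) \<le> (\<Sum>k\<in>particles. (norm (v k (t n)))\<^sup>2)"
    and "k \<in> particles \<Longrightarrow> x k (t (Suc n)) - x k (t n) = (t (Suc n) - t n) *\<^sub>R v k (t (Suc n))"
proof -
  have mono: "strict_mono t" and rng: "range t = collision_times \<tau> x"
    and flow: "inelastic_flow r \<tau> x v"
    using assms by (auto simp: inelastic_collapse_def)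
  have in_coll: "t m \<in> collision_times \<tau> x" for m
    using rng by blast
  have lt: "t n < t (Suc n)"
    using mono by (simp add: strict_mono_Suc_iff)
  have "0 \<le> t n \<and> t n < t (Suc n) \<and> t (Suc n) < \<tau>"
    using in_coll[of n] in_coll[of "Suc n"] lt by (auto simp: collision_times_def)
  \<comment> \<open>Every collision time is some \<open>t m\<close>, and strict monotonicity leaves
    no \<open>m\<close> strictly between \<open>n\<close> and \<open>Suc n\<close>.\<close>
  moreover have "{t n<..<t (Suc n)} \<inter> collision_times \<tau> x = {}"
    unfolding rng[symmetric] using mono by (auto simp: strict_mono_less)
  ultimately have "\<exists>u'. velocities_after r x v (t n) u' \<and>
      (\<forall>k\<in>particles. \<forall>s\<in>{t n<..t (Suc n)}. v k s = u' k \<and> x k s = x k (t n) + (s - t n) *\<^sub>R u' k)"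
    using flow unfolding inelastic_flow_def by presburger
  then obtain u' where u': "velocities_after r x v (t n) u'"
    and free: "\<And>k s. k \<in> particles \<Longrightarrow> s \<in> {t n<..t (Suc n)} \<Longrightarrow>
      v k s = u' k \<and> x k s = x k (t n) + (s - t n) *\<^sub>R u' k"
    by blast
  have v: "v k (t (Suc n)) = u' k" if "k \<in> particles" for k
    using free[OF that] lt by simp
  obtain i j where c: "contact x (t n) i j"
    using in_coll[of n] by (auto simp: collision_times_def)
  have "collision_rule r i j (sgn (x i (t n) - x j (t n))) (\<lambda>k. v k (t n)) u'"
    using u' c by (auto simp: velocities_after_def)
  then have "(\<Sum>k\<in>particles. (norm (u' k))\<^sup>2) \<le> (\<Sum>k\<in>particles. (norm (v k (t n)))\<^sup>2)"
    by (rule collision_energy_le) (use c assms(2) in \<open>auto simp: contact_def norm_sgn\<close>)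
  then show "(\<Sum>k\<in>particles. (norm (v k (t (Suc n))))\<^sup>2) \<le> (\<Sum>k\<in>particles. (norm (v k (t n)))\<^sup>2)"
    using v by simp
  show "x k (t (Suc n)) - x k (t n) = (t (Suc n) - t n) *\<^sub>R v k (t (Suc n))"
    if "k \<in> particles"
    using free[OF that, of "t (Suc n)"] lt by simp
qed

text \<open>Each speed at a collision time is at most \<open>sqrt (E 0)\<close>, the square root of
  the initial sum of squared speeds, so this constant serves as the Lipschitz factor
  \<open>M\<close> relative to the convergent times.\<close>

lemma collapse_position_convergent:
  assumes "inelastic_collapse r \<tau> x v t" and "\<bar>r\<bar> \<le> 1" and "k \<in> particles"
  shows "convergent (\<lambda>n. x k (t n))"
proof (rule convergent_if_norm_diff_le_mult_diff)
  define E where "E n = (\<Sum>k\<in>particles. (norm (v k (t n)))\<^sup>2)" for n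
  have "decseq E"
    unfolding E_def by (intro decseq_SucI collapse_step(1)[OF assms(1,2)])
  show "convergent t"
    using assms(1) by (auto simp: inelastic_collapse_def convergent_def)
  fix n
  have "(norm (v k (t (Suc n))))\<^sup>2 \<le> E (Suc n)"
    unfolding E_def using assms(3) by (intro member_le_sum) auto
  also have "\<dots> \<le> E 0"
    using \<open>decseq E\<close> by (simp add: decseqD)
  finally have "norm (v k (t (Suc n))) \<le> sqrt (E 0)"
    by (rule real_le_rsqrt)
  moreover have "t n < t (Suc n)"
    using assms(1) by (simp add: inelastic_collapse_def strict_mono_Suc_iff)
  ultimately show "norm (x k (t (Suc n)) - x k (t n)) \<le> sqrt (E 0) * (t (Suc n) - t n)"
    unfolding collapse_step(2)[OF assms] by (simp add: mult.commute mult_left_mono)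
qed

theorem proposition9:
  fixes r \<tau> :: real
    and x v :: "nat \<Rightarrow> real \<Rightarrow> 'a::euclidean_space"
    and t :: "nat \<Rightarrow> real"
  assumes "DIM('a) \<ge> 2"
    and "0 < r" and "r < 1"
    and "triangular_collapse r \<tau> x v t"
  shows "(\<forall>i \<in> {1, 2}. convergent (\<lambda>n. x i (t n) - x 0 (t n))) \<and>
    norm (limit_position x t 1) = 1 \<and>
    norm (limit_position x t 2) = 1 \<and>
    norm (limit_position x t 2 - limit_position x t 1) = 1"
proof -
  have collapse: "inelastic_collapse r \<tau> x v t"
    using assms(4) by (simp add: triangular_collapse_def)
  have conv: "convergent (\<lambda>n. x i (t n) - x j (t n))" if "i \<in> particles" "j \<in> particles" for i j
    using that assms(2,3) by (intro convergent_diff collapse_position_convergent[OF collapse]) auto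
  \<comment> \<open>The order of \<open>i\<close> and \<open>j\<close> is reversed in the difference
    so that a contact of \<open>0\<close> with \<open>1\<close> or \<open>2\<close> yields exactly
    the sequence defining \<open>limit_position\<close>.\<close>
  have lim: "norm (lim (\<lambda>n. x j (t n) - x i (t n))) = 1"
    if "infinite {n. contact x (t n) i j}" "i \<in> particles" "j \<in> particles" for i j
  proof (rule norm_lim_eq_if_infinite[OF conv])
    show "infinite {n. norm (x j (t n) - x i (t n)) = 1}"
      using that(1) by (rule infinite_super[rotated]) (auto simp: contact_def norm_minus_commute)
  qed (use that in auto)
  have limit: "(\<lambda>n. x i (t n) - x 0 (t n)) \<longlonglongrightarrow> limit_position x t i" if "i \<in> particles" for i
    unfolding limit_position_def using conv[of i 0] that by (simp add: convergent_LIMSEQ_iff)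
  \<comment> \<open>The position of particle \<open>0\<close> cancels, so the difference of the two
    limits is the limit for the pair \<open>1\<close>, \<open>2\<close>, to which \<open>lim\<close>
    applies.\<close>
  have "(\<lambda>n. (x 2 (t n) - x 0 (t n)) - (x 1 (t n) - x 0 (t n)))
      \<longlonglongrightarrow> limit_position x t 2 - limit_position x t 1"
    by (intro tendsto_diff limit) auto
  then have "limit_position x t 2 - limit_position x t 1 = lim (\<lambda>n. x 2 (t n) - x 1 (t n))"
    by (simp add: limI)
  then show ?thesis
    using conv lim assms(4) by (simp add: limit_position_def triangular_collapse_def)
qed

end
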